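(* (Arbitrary vs. Arbitrary, lower bound.) For all sufficiently large $n$, there is a nonempty set $\mathcal{A} \subsetneq \{0,1\}^n$ such that every first-order $\tau_{\mathsf{string}}$-sentence that is true in $\mathbf{B}_w$ for all $w \in \mathcal{A}$ and false in $\mathbf{B}_{w'}$ for all $w' \in \{0,1\}^n\setminus\mathcal{A}$ has at least $n/\log(n)$ quantifiers.
   Context: $\tau_{\mathsf{string}} = \langle <, S; \mathsf{min}, \mathsf{max}\rangle$ with $<$ binary, $S$ unary, $\mathsf{min},\mathsf{max}$ constants. A string $w = w_1\cdots w_n \in \{0,1\}^n$ is encoded by the structure $\mathbf{B}_w$ with universe $\{1,\dots,n\}$, $<$ the usual order, $S = \{i : w_i = 1\}$, $\mathsf{min}=1$, $\mathsf{max}=n$. The number of quantifiers of a sentence is the number of quantifier occurrences. $\log$ is base 2. *)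

theory Defs
  imports Complex_Main
begin

text \<open>Structures for the vocabulary \<open>\<langle><, S; min, max\<rangle>\<close>.\<close>

record 'a string_structure =
  universe :: "'a set"
  lt :: "'a \<Rightarrow> 'a \<Rightarrow> bool"
  S :: "'a \<Rightarrow> bool"
  minc :: 'a
  maxc :: 'a

datatype fo_term = Var nat | MinC | MaxC

text \<open>First-order logic with equality. Implication abbreviates \<open>\<not>\<phi> \<or> \<psi>\<close>. There is
  deliberately no primitive biconditional: spelled out, it repeats the quantifiers of
  both its sides, and the measure below counts quantifier occurrences.\<close>

datatype fo_formula =
    Eq fo_term fo_term
  | Less fo_term fo_term
  | Bit fo_term
  | Neg fo_formula
  | Conj fo_formula fo_formula
  | Disj fo_formula fo_formula
  | Ex nat fo_formula
  | All nat fo_formula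

fun term_vars :: "fo_term \<Rightarrow> nat set" where
  "term_vars (Var x) = {x}"
| "term_vars MinC = {}"
| "term_vars MaxC = {}"

fun free_vars :: "fo_formula \<Rightarrow> nat set" where
  "free_vars (Eq s t) = term_vars s \<union> term_vars t"
| "free_vars (Less s t) = term_vars s \<union> term_vars t"
| "free_vars (Bit t) = term_vars t"
| "free_vars (Neg \<phi>) = free_vars \<phi>"
| "free_vars (Conj \<phi> \<psi>) = free_vars \<phi> \<union> free_vars \<psi>"
| "free_vars (Disj \<phi> \<psi>) = free_vars \<phi> \<union> free_vars \<psi>"
| "free_vars (Ex x \<phi>) = free_vars \<phi> - {x}"
| "free_vars (All x \<phi>) = free_vars \<phi> - {x}"

definition sentence :: "fo_formula \<Rightarrow> bool" where
  "sentence \<phi> \<longleftrightarrow> free_vars \<phi> = {}"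

fun num_quantifiers :: "fo_formula \<Rightarrow> nat" where
  "num_quantifiers (Eq s t) = 0"
| "num_quantifiers (Less s t) = 0"
| "num_quantifiers (Bit t) = 0"
| "num_quantifiers (Neg \<phi>) = num_quantifiers \<phi>"
| "num_quantifiers (Conj \<phi> \<psi>) = num_quantifiers \<phi> + num_quantifiers \<psi>"
| "num_quantifiers (Disj \<phi> \<psi>) = num_quantifiers \<phi> + num_quantifiers \<psi>"
| "num_quantifiers (Ex x \<phi>) = Suc (num_quantifiers \<phi>)"
| "num_quantifiers (All x \<phi>) = Suc (num_quantifiers \<phi>)"

fun term_val :: "'a string_structure \<Rightarrow> (nat \<Rightarrow> 'a) \<Rightarrow> fo_term \<Rightarrow> 'a" where
  "term_val B e (Var x) = e x"
| "term_val B e MinC = minc B"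
| "term_val B e MaxC = maxc B"

fun sat :: "'a string_structure \<Rightarrow> (nat \<Rightarrow> 'a) \<Rightarrow> fo_formula \<Rightarrow> bool" where
  "sat B e (Eq s t) \<longleftrightarrow> term_val B e s = term_val B e t"
| "sat B e (Less s t) \<longleftrightarrow> lt B (term_val B e s) (term_val B e t)"
| "sat B e (Bit t) \<longleftrightarrow> S B (term_val B e t)"
| "sat B e (Neg \<phi>) \<longleftrightarrow> \<not> sat B e \<phi>"
| "sat B e (Conj \<phi> \<psi>) \<longleftrightarrow> sat B e \<phi> \<and> sat B e \<psi>"
| "sat B e (Disj \<phi> \<psi>) \<longleftrightarrow> sat B e \<phi> \<or> sat B e \<psi>"
| "sat B e (Ex x \<phi>) \<longleftrightarrow> (\<exists>a \<in> universe B. sat B (e(x := a)) \<phi>)"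
| "sat B e (All x \<phi>) \<longleftrightarrow> (\<forall>a \<in> universe B. sat B (e(x := a)) \<phi>)"

text \<open>For a sentence the assignment is irrelevant, so over a nonempty universe the
  negation of \<open>is_true_in\<close> says that the sentence is false.\<close>

definition is_true_in :: "fo_formula \<Rightarrow> 'a string_structure \<Rightarrow> bool" where
  "is_true_in \<phi> B \<longleftrightarrow> (\<forall>e. range e \<subseteq> universe B \<longrightarrow> sat B e \<phi>)"

text \<open>Bit strings are Boolean lists, with \<open>True\<close> for 1. Positions are numbered from 1,
  whereas list indices start at 0. The encoding is meant for nonempty strings.\<close>

definition bit_strings :: "nat \<Rightarrow> bool list set" where
  "bit_strings n = {w. length w = n}"

definition string_encoding :: "bool list \<Rightarrow> nat string_structure" where
  "string_encoding w =
    \<lparr>universe = {1..length w},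
     lt = (<),
     S = (\<lambda>i. i \<in> {1..length w} \<and> w ! (i - 1)),
     minc = 1,
     maxc = length w\<rparr>"

end

theory Submission imports Defs "HOL-Real_Asymp.Real_Asymp" begin

text \<open>Counting. Bringing a sentence into prenex form keeps the number \<open>k\<close> of quantifiers,
  and the truth value of the quantifier-free matrix depends only on the order type of the
  \<open>k\<close> variables and the two constants, and on the bits at these positions. There are at
  most \<open>t = (2 (k + 2))^(k + 2)\<close> such atomic types, hence at most \<open>2^(k + t)\<close> definable
  properties of strings of length \<open>n\<close>. For \<open>k < n / log n\<close> and large \<open>n\<close> this is less than
  \<open>2^(2^n) - 2\<close>, the number of nonempty proper subsets of \<open>{0,1}^n\<close>.\<close>

section \<open>Prenex predicates and their closure properties\<close>

definition same_type ::
  "nat \<Rightarrow> (nat \<Rightarrow> bool) \<Rightarrow> (nat \<Rightarrow> nat) \<Rightarrow> (nat \<Rightarrow> bool) \<Rightarrow> (nat \<Rightarrow> nat) \<Rightarrow> bool" where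
  "same_type m s e s' e' \<longleftrightarrow>
     (\<forall>i<m. s (e i) = s' (e' i)) \<and> (\<forall>i<m. \<forall>j<m. e i < e j \<longleftrightarrow> e' i < e' j)"

text \<open>The universe \<open>U\<close> is a parameter because all strings of one length share it;
  only the bits \<open>s\<close> and the assignment \<open>e\<close> vary.\<close>

definition ex_op where
  "ex_op U m P = (\<lambda>(s :: nat \<Rightarrow> bool) (e :: nat \<Rightarrow> nat). \<exists>a\<in>U. P s (e(m := a)))"

definition all_op where
  "all_op U m P = (\<lambda>(s :: nat \<Rightarrow> bool) (e :: nat \<Rightarrow> nat). \<forall>a\<in>U. P s (e(m := a)))"

text \<open>The semantic counterpart of prenex formulas with \<open>k\<close> quantifiers and free variables
  below \<open>m\<close>, where \<open>s\<close> is the set of ones and \<open>e\<close> the assignment. As bound variables are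
  numbered consecutively from \<open>m\<close>, there are only two choices for each quantifier.\<close>

fun prenex :: "nat set \<Rightarrow> nat \<Rightarrow> nat \<Rightarrow> ((nat \<Rightarrow> bool) \<Rightarrow> (nat \<Rightarrow> nat) \<Rightarrow> bool) \<Rightarrow> bool" where
  "prenex U m 0 P \<longleftrightarrow> (\<forall>s e s' e'. same_type m s e s' e' \<longrightarrow> P s e = P s' e')"
| "prenex U m (Suc k) P \<longleftrightarrow>
     (\<exists>P'. prenex U (Suc m) k P' \<and> (P = ex_op U m P' \<or> P = all_op U m P'))"

declare prenex.simps [simp del]

lemma prenex_0I:
  "(\<And>s e s' e'. same_type m s e s' e' \<Longrightarrow> P s e = P s' e') \<Longrightarrow> prenex U m 0 P"
  unfolding prenex.simps by (intro allI impI)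

lemma prenex_0D: "prenex U m 0 P \<Longrightarrow> same_type m s e s' e' \<Longrightarrow> P s e = P s' e'"
  unfolding prenex.simps by (elim allE impE)

lemma prenex_SucI:
  "prenex U (Suc m) k P' \<Longrightarrow> P = ex_op U m P' \<or> P = all_op U m P' \<Longrightarrow> prenex U m (Suc k) P"
  unfolding prenex.simps by (intro exI conjI)

lemma prenex_SucE:
  assumes "prenex U m (Suc k) P"
  obtains P' where "prenex U (Suc m) k P'" "P = ex_op U m P' \<or> P = all_op U m P'"
  using assms unfolding prenex.simps by (elim exE conjE)

text \<open>Assignments that agree below \<open>m\<close> have the same atomic type, and each
  quantifier overwrites the only further index that its body may read.\<close>

lemma prenex_local_all:
  "prenex U m k P \<Longrightarrow> \<forall>s e e'. (\<forall>i<m. e i = e' i) \<longrightarrow> P s e = P s e'"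
proof (induction k arbitrary: m P)
  case 0
  have "same_type m s e s e'" if "\<forall>i<m. e i = e' i" for s e e'
    using that by (simp add: same_type_def)
  then show ?case by (intro allI impI prenex_0D[OF 0])
next
  case (Suc k)
  from Suc.prems(1) obtain P' where P': "prenex U (Suc m) k P'"
    and eq: "P = ex_op U m P' \<or> P = all_op U m P'" by (rule prenex_SucE)
  have *: "P' s (e(m := a)) = P' s (e'(m := a))" if "\<forall>i<m. e i = e' i" for s e e' a
    using Suc.IH[OF P'] that by (simp add: less_Suc_eq)
  have "P s e = P s e'" if "\<forall>i<m. e i = e' i" for s e e'
    using eq *[OF that] by (auto simp: ex_op_def all_op_def)
  then show ?case by blast
qed

lemma prenex_local:
  "prenex U m k P \<Longrightarrow> (\<And>i. i < m \<Longrightarrow> e i = e' i) \<Longrightarrow> P s e = P s e'"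
  using prenex_local_all by blast

text \<open>Negation turns each quantifier of the prefix into its dual, so the length of the prefix
  stays the same.\<close>

lemma prenex_not: "prenex U m k P \<Longrightarrow> prenex U m k (\<lambda>s e. \<not> P s e)"
proof (induction k arbitrary: m P)
  case 0
  show ?case by (rule prenex_0I, drule prenex_0D[OF 0]) simp
next
  case (Suc k)
  from Suc.prems(1) obtain P' where P': "prenex U (Suc m) k P'"
    and eq: "P = ex_op U m P' \<or> P = all_op U m P'" by (rule prenex_SucE)
  have "(\<lambda>s e. \<not> P s e) = ex_op U m (\<lambda>s e. \<not> P' s e)
      \<or> (\<lambda>s e. \<not> P s e) = all_op U m (\<lambda>s e. \<not> P' s e)"
    using eq by (auto simp: ex_op_def all_op_def fun_eq_iff)
  then show ?case by (rule prenex_SucI[OF Suc.IH[OF P']])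
qed

definition rename where
  "rename f P = (\<lambda>(s :: nat \<Rightarrow> bool) (e :: nat \<Rightarrow> nat). P s (e \<circ> (f :: nat \<Rightarrow> nat)))"

lemma prenex_rename:
  assumes "prenex U m k P" "\<And>i. i < m \<Longrightarrow> f i < m'"
  shows "prenex U m' k (rename f P)"
  using assms
proof (induction k arbitrary: m P m' f)
  case 0
  have "same_type m s (e \<circ> f) s' (e' \<circ> f)" if "same_type m' s e s' e'" for s e s' e'
    using that 0(2) by (simp add: same_type_def)
  then show ?case unfolding rename_def by (intro prenex_0I prenex_0D[OF 0(1)])
next
  case (Suc k)
  from Suc.prems(1) obtain P' where P': "prenex U (Suc m) k P'"
    and eq: "P = ex_op U m P' \<or> P = all_op U m P'" by (rule prenex_SucE)
  \<comment> \<open>The index bound by the outermost quantifier is \<open>m\<close> in the old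
    numbering and has to be \<open>m'\<close> in the new one.\<close>
  let ?g = "f(m := m')"
  have *: "P' s ((e \<circ> f)(m := a)) = P' s (e(m' := a) \<circ> ?g)" for s e a
    by (rule prenex_local[OF P']) (use Suc.prems(2) in \<open>fastforce simp: less_Suc_eq\<close>)
  have "rename f P = ex_op U m' (rename ?g P') \<or> rename f P = all_op U m' (rename ?g P')"
    using eq by (auto simp: rename_def ex_op_def all_op_def *)
  moreover have "prenex U (Suc m') k (rename ?g P')"
    by (rule Suc.IH[OF P']) (use Suc.prems(2) in \<open>auto simp: less_Suc_eq\<close>)
  ultimately show ?case by (rule prenex_SucI[rotated])
qed

lemma prenex_weaken: "prenex U m k P \<Longrightarrow> prenex U (Suc m) k P"
  using prenex_rename[of U m k P "\<lambda>i. i" "Suc m"] by (simp add: rename_def comp_def)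

lemma prenex_upd: "prenex U m k P \<Longrightarrow> P s (e(m := a)) = P s e"
  using prenex_local[of U m k P "e(m := a)" e s] by simp

text \<open>The outermost quantifier of \<open>P\<close> can be pulled over \<open>Q\<close>, since
  \<open>Q\<close> does not read index \<open>m\<close>. For a universal quantifier this needs
  \<open>U\<close> to be nonempty. How the rest of \<open>P\<close> merges with \<open>Q\<close> is
  left to the premise \<open>conj\<close>, so that the lemma serves the inductions on either
  conjunct.\<close>

lemma prenex_conj_Suc:
  assumes "U \<noteq> {}" "prenex U m (Suc k) P" "prenex U m l Q"
    and conj: "\<And>P'. prenex U (Suc m) k P' \<Longrightarrow> prenex U (Suc m) j (\<lambda>s e. P' s e \<and> Q s e)"
  shows "prenex U m (Suc j) (\<lambda>s e. P s e \<and> Q s e)"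
proof -
  obtain P' where P': "prenex U (Suc m) k P'"
    and eq: "P = ex_op U m P' \<or> P = all_op U m P'" using assms(2) by (rule prenex_SucE)
  have "(\<lambda>s e. P s e \<and> Q s e) = ex_op U m (\<lambda>s e. P' s e \<and> Q s e)
      \<or> (\<lambda>s e. P s e \<and> Q s e) = all_op U m (\<lambda>s e. P' s e \<and> Q s e)"
    using eq \<open>U \<noteq> {}\<close> prenex_upd[OF assms(3)]
    by (auto simp: ex_op_def all_op_def fun_eq_iff)
  then show ?thesis by (rule prenex_SucI[OF conj[OF P']])
qed

text \<open>The outer induction strips the prefix of \<open>P\<close>; once \<open>P\<close> is
  quantifier-free, the inner one strips the prefix of \<open>Q\<close>, with the conjuncts swapped.
  The conjunct that is not stripped is weakened to the larger index bound.\<close>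

lemma prenex_conj:
  assumes "U \<noteq> {}" "prenex U m k P" "prenex U m l Q"
  shows "prenex U m (k + l) (\<lambda>s e. P s e \<and> Q s e)"
  using assms(2,3)
proof (induction k arbitrary: m P Q)
  case 0
  then show ?case
  proof (induction l arbitrary: m P Q)
    case 0
    show ?case unfolding add_0
      by (rule prenex_0I) (use prenex_0D[OF 0(1)] prenex_0D[OF 0(2)] in blast)
  next
    case (Suc l)
    have "prenex U m (Suc l) (\<lambda>s e. Q s e \<and> P s e)"
      using Suc.IH[OF prenex_weaken[OF Suc.prems(1)]]
      by (intro prenex_conj_Suc[OF \<open>U \<noteq> {}\<close> Suc.prems(2,1)]) (simp add: conj_commute)
    then show ?case by (simp add: conj_commute)
  qed
next
  case (Suc k)
  then show ?case
    using prenex_conj_Suc[OF \<open>U \<noteq> {}\<close> Suc.prems] Suc.IH prenex_weaken by simp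
qed

lemma prenex_disj:
  assumes "U \<noteq> {}" "prenex U m k P" "prenex U m l Q"
  shows "prenex U m (k + l) (\<lambda>s e. P s e \<or> Q s e)"
  using prenex_not[OF prenex_conj[OF assms(1) prenex_not[OF assms(2)] prenex_not[OF assms(3)]]]
  by simp

text \<open>The prefix is padded by conjoining the constant \<open>True\<close> under
  \<open>l - k\<close> dummy universal quantifiers. Thus counting for one \<open>k\<close> covers
  all sentences with at most \<open>k\<close> quantifiers.\<close>

lemma prenex_mono:
  assumes "U \<noteq> {}" "prenex U m k P" "k \<le> l"
  shows "prenex U m l P"
proof -
  have "prenex U m j (\<lambda>s e. True)" for j
  proof (induction j arbitrary: m)
    case (Suc j)
    have "(\<lambda>s e. True) = all_op U m (\<lambda>s e. True)" by (simp add: all_op_def)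
    then show ?case by (intro prenex_SucI[OF Suc.IH]) simp
  qed (simp add: prenex_0I)
  then show ?thesis
    using prenex_conj[OF assms(1,2), of "l - k" "\<lambda>s e. True"] assms(3) by simp
qed

section \<open>Counting atomic types and prenex predicates\<close>

text \<open>A canonical code of the type: the rank of each value among the \<open>m\<close> values,
  with its bit. Lists of bounded entries are easy to count.\<close>

definition atomic_type :: "nat \<Rightarrow> (nat \<Rightarrow> bool) \<Rightarrow> (nat \<Rightarrow> nat) \<Rightarrow> (nat \<times> bool) list" where
  "atomic_type m s e = map (\<lambda>i. (card {j. j < m \<and> e j < e i}, s (e i))) [0..<m]"

lemma atomic_type_imp_same_type:
  assumes "atomic_type m s e = atomic_type m s' e'"
  shows "same_type m s e s' e'"
proof -
  define r where "r = (\<lambda>(e :: nat \<Rightarrow> nat) i. card {j. j < m \<and> e j < e i})"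
  \<comment> \<open>If \<open>e i < e j\<close>, the indices counted for \<open>i\<close> are among
    those counted for \<open>j\<close>, and \<open>i\<close> itself is counted only for
    \<open>j\<close>; so ranks order the indices as the values do.\<close>
  have *: "r e i < r e j \<longleftrightarrow> e i < e j" if "i < m" for e i j
  proof
    assume "e i < e j"
    then show "r e i < r e j"
      unfolding r_def using that by (intro psubset_card_mono) auto
  next
    assume "r e i < r e j"
    moreover have "r e j \<le> r e i" if "e j \<le> e i"
      unfolding r_def using that by (intro card_mono) auto
    ultimately show "e i < e j" by force
  qed
  have "r e i = r e' i \<and> s (e i) = s' (e' i)" if "i < m" for i
    using assms that by (simp add: atomic_type_def r_def)
  then show ?thesis
    unfolding same_type_def using *[of _ e] *[of _ e'] by metis
qed

lemma atomic_type_in_lists: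
  "atomic_type m s e \<in> {xs. set xs \<subseteq> {..<m} \<times> UNIV \<and> length xs = m}"
proof -
  have "card {j. j < m \<and> e j < e i} < m" if "i < m" for i
  proof -
    have "card {j. j < m \<and> e j < e i} < card {..<m}"
      using that by (intro psubset_card_mono) auto
    then show ?thesis by simp
  qed
  then show ?thesis by (auto simp: atomic_type_def)
qed

text \<open>Without quantifiers a predicate is given by a set of atomic types, of which there are at
  most \<open>(2 * m) ^ m\<close>. Each quantifier at most doubles the count, and
  \<open>m + k\<close>, the total number of indices, stays constant along the induction.\<close>

lemma card_prenex:
  "finite (Collect (prenex U m k)) \<and>
   card (Collect (prenex U m k)) \<le> 2 ^ (k + (2 * (m + k)) ^ (m + k))"
proof (induction k arbitrary: m)
  case 0
  let ?T = "{xs :: (nat \<times> bool) list. set xs \<subseteq> {..<m} \<times> UNIV \<and> length xs = m}"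
  have fin: "finite ({..<m} \<times> (UNIV :: bool set))" by simp
  have finT: "finite ?T" using finite_lists_length_eq[OF fin] .
  have cardT: "card ?T = (2 * m) ^ m"
    using card_lists_length_eq[OF fin, of m] by (simp add: card_cartesian_product mult.commute)
  let ?F = "\<lambda>T s e. atomic_type m s e \<in> T"
  have sub: "Collect (prenex U m 0) \<subseteq> ?F ` Pow ?T"
  proof
    fix P assume "P \<in> Collect (prenex U m 0)"
    then have inv: "P s e = P s' e'" if "same_type m s e s' e'" for s e s' e'
      using that prenex_0D by blast
    let ?T' = "{atomic_type m s e | s e. P s e}"
    \<comment> \<open>By invariance, a pair satisfies \<open>P\<close> as soon as its type is that
      of some satisfying pair.\<close>
    have "P = ?F ?T'"
      using inv atomic_type_imp_same_type by (fastforce simp: fun_eq_iff)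
    moreover have "?T' \<in> Pow ?T"
      using atomic_type_in_lists by blast
    ultimately show "P \<in> ?F ` Pow ?T" by (rule image_eqI)
  qed
  have finF: "finite (?F ` Pow ?T)" using finT by simp
  have "card (Collect (prenex U m 0)) \<le> card (?F ` Pow ?T)"
    by (rule card_mono[OF finF sub])
  also have "\<dots> \<le> card (Pow ?T)" using finT by (intro card_image_le) simp
  also have "\<dots> = 2 ^ (2 * m) ^ m" using finT by (simp add: card_Pow cardT)
  finally show ?case using finite_subset[OF sub finF] by simp
next
  case (Suc k)
  let ?C = "Collect (prenex U (Suc m) k)"
  have eq: "Collect (prenex U m (Suc k)) = ex_op U m ` ?C \<union> all_op U m ` ?C"
    by (auto elim!: prenex_SucE intro: prenex_SucI)
  have fin: "finite ?C" and le: "card ?C \<le> 2 ^ (k + (2 * (Suc m + k)) ^ (Suc m + k))"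
    using Suc by blast+
  have "card (ex_op U m ` ?C \<union> all_op U m ` ?C) \<le> card ?C + card ?C"
    by (rule order_trans[OF card_Un_le add_mono[OF card_image_le[OF fin] card_image_le[OF fin]]])
  then have "card (Collect (prenex U m (Suc k))) \<le> 2 * card ?C"
    unfolding eq by simp
  then show ?case using le fin eq by simp
qed

section \<open>Translating formulas into prenex predicates\<close>

text \<open>Indices 0 and 1 of the assignment hold the two constants; \<open>\<rho>\<close> renames the variables
  of the formula to indices.\<close>

fun term_index :: "(nat \<Rightarrow> nat) \<Rightarrow> fo_term \<Rightarrow> nat" where
  "term_index \<rho> (Var x) = \<rho> x"
| "term_index \<rho> MinC = 0"
| "term_index \<rho> MaxC = 1"

lemma term_val_index:
  "e 0 = 1 \<Longrightarrow> e 1 = length w \<Longrightarrow>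
    term_val (string_encoding w) (e \<circ> \<rho>) t = e (term_index \<rho> t)"
  by (cases t) (auto simp: string_encoding_def)

text \<open>A single \<open>P\<close> must serve all strings of length \<open>n\<close>, seeing them
  only through \<open>S\<close>. The assignment of the formula factors through the indices, so a
  variable name bound repeatedly can get a new index each time.\<close>

definition expresses where
  "expresses n \<rho> \<phi> P \<longleftrightarrow> (\<forall>w e. length w = n \<and> e 0 = 1 \<and> e 1 = n \<longrightarrow>
     sat (string_encoding w) (e \<circ> \<rho>) \<phi> = P (S (string_encoding w)) e)"

lemma universe_string_encoding: "universe (string_encoding w) = {1..length w}"
  by (simp add: string_encoding_def)

lemma comp_fun_upd:
  fixes e :: "nat \<Rightarrow> nat"
  assumes "range \<rho> \<subseteq> {..<m}"
  shows "(e \<circ> \<rho>)(x := a) = e(m := a) \<circ> \<rho>(x := m)"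
  using assms by (force simp: fun_eq_iff)

text \<open>The fresh index \<open>m\<close> lies outside the range of \<open>\<rho>\<close>, so
  binding \<open>x\<close> disturbs no other variable; \<open>m \<ge> 2\<close> protects the indices
  of the two constants.\<close>

lemma expresses_Ex:
  assumes "expresses n (\<rho>(x := m)) \<phi> P" "range \<rho> \<subseteq> {..<m}" "m \<ge> 2"
  shows "expresses n \<rho> (Ex x \<phi>) (ex_op {1..n} m P)"
  unfolding expresses_def
proof (intro allI impI, elim conjE)
  fix w :: "bool list" and e :: "nat \<Rightarrow> nat"
  assume w: "length w = n" and e: "e 0 = 1" "e 1 = n"
  have "sat (string_encoding w) ((e \<circ> \<rho>)(x := a)) \<phi> = P (S (string_encoding w)) (e(m := a))" for a
    using assms(1,3) w e unfolding expresses_def comp_fun_upd[OF assms(2)] by simp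
  then show "sat (string_encoding w) (e \<circ> \<rho>) (Ex x \<phi>)
      = ex_op {1..n} m P (S (string_encoding w)) e"
    using w by (simp add: ex_op_def universe_string_encoding del: fun_upd_apply comp_apply)
qed

lemma expresses_All:
  assumes "expresses n (\<rho>(x := m)) \<phi> P" "range \<rho> \<subseteq> {..<m}" "m \<ge> 2"
  shows "expresses n \<rho> (All x \<phi>) (all_op {1..n} m P)"
  unfolding expresses_def
proof (intro allI impI, elim conjE)
  fix w :: "bool list" and e :: "nat \<Rightarrow> nat"
  assume w: "length w = n" and e: "e 0 = 1" "e 1 = n"
  have "sat (string_encoding w) ((e \<circ> \<rho>)(x := a)) \<phi> = P (S (string_encoding w)) (e(m := a))" for a
    using assms(1,3) w e unfolding expresses_def comp_fun_upd[OF assms(2)] by simp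
  then show "sat (string_encoding w) (e \<circ> \<rho>) (All x \<phi>)
      = all_op {1..n} m P (S (string_encoding w)) e"
    using w by (simp add: all_op_def universe_string_encoding del: fun_upd_apply comp_apply)
qed

text \<open>The closure properties add up prefix lengths exactly as \<open>num_quantifiers\<close>
  does. The induction varies \<open>\<rho>\<close> and \<open>m\<close>, since a binder extends
  both.\<close>

lemma prenex_form:
  assumes "n \<ge> 1" "range \<rho> \<subseteq> {..<m}" "m \<ge> 2"
  shows "\<exists>P. prenex {1..n} m (num_quantifiers \<phi>) P \<and> expresses n \<rho> \<phi> P"
  using assms(2,3)
proof (induction \<phi> arbitrary: \<rho> m)
  case (Eq t u)
  let ?t = "term_index \<rho> t" and ?u = "term_index \<rho> u"
  have ix: "?t < m" "?u < m" using Eq by (cases t; cases u; auto)+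
  \<comment> \<open>\<open>same_type\<close> speaks of the strict order only, so equality is written
    as the failure of both comparisons.\<close>
  have "prenex {1..n} m (num_quantifiers (Eq t u)) (\<lambda>s e. \<not> e ?t < e ?u \<and> \<not> e ?u < e ?t)"
    unfolding num_quantifiers.simps by (rule prenex_0I) (simp add: same_type_def ix)
  moreover have "expresses n \<rho> (Eq t u) (\<lambda>s e. \<not> e ?t < e ?u \<and> \<not> e ?u < e ?t)"
    by (auto simp: expresses_def term_val_index simp del: comp_apply)
  ultimately show ?case by (intro exI conjI)
next
  case (Less t u)
  let ?t = "term_index \<rho> t" and ?u = "term_index \<rho> u"
  have ix: "?t < m" "?u < m" using Less by (cases t; cases u; auto)+
  have "prenex {1..n} m (num_quantifiers (Less t u)) (\<lambda>s e. e ?t < e ?u)"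
    unfolding num_quantifiers.simps by (rule prenex_0I) (simp add: same_type_def ix)
  moreover have "expresses n \<rho> (Less t u) (\<lambda>s e. e ?t < e ?u)"
    by (simp add: expresses_def term_val_index del: comp_apply)
    (simp add: string_encoding_def)
  ultimately show ?case by (intro exI conjI)
next
  case (Bit t)
  let ?t = "term_index \<rho> t"
  have ix: "?t < m" using Bit by (cases t) auto
  have "prenex {1..n} m (num_quantifiers (Bit t)) (\<lambda>s e. s (e ?t))"
    unfolding num_quantifiers.simps by (rule prenex_0I) (simp add: same_type_def ix)
  moreover have "expresses n \<rho> (Bit t) (\<lambda>s e. s (e ?t))"
    by (simp add: expresses_def term_val_index del: comp_apply)
  ultimately show ?case by (intro exI conjI)
next
  case (Neg \<phi>)
  obtain P where P: "prenex {1..n} m (num_quantifiers \<phi>) P" "expresses n \<rho> \<phi> P"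
    using Neg.IH[OF Neg.prems] by blast
  have "prenex {1..n} m (num_quantifiers (Neg \<phi>)) (\<lambda>s e. \<not> P s e)"
    using prenex_not[OF P(1)] by simp
  moreover have "expresses n \<rho> (Neg \<phi>) (\<lambda>s e. \<not> P s e)"
    using P(2) by (simp add: expresses_def del: comp_apply)
  ultimately show ?case by (intro exI conjI)
next
  case (Conj \<phi> \<psi>)
  obtain P Q where P: "prenex {1..n} m (num_quantifiers \<phi>) P" "expresses n \<rho> \<phi> P"
    and Q: "prenex {1..n} m (num_quantifiers \<psi>) Q" "expresses n \<rho> \<psi> Q"
    using Conj.IH(1)[OF Conj.prems] Conj.IH(2)[OF Conj.prems] by blast
  have "prenex {1..n} m (num_quantifiers (Conj \<phi> \<psi>)) (\<lambda>s e. P s e \<and> Q s e)"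
    using prenex_conj[OF _ P(1) Q(1)] \<open>n \<ge> 1\<close> by simp
  moreover have "expresses n \<rho> (Conj \<phi> \<psi>) (\<lambda>s e. P s e \<and> Q s e)"
    using P(2) Q(2) by (simp add: expresses_def del: comp_apply)
  ultimately show ?case by (intro exI conjI)
next
  case (Disj \<phi> \<psi>)
  obtain P Q where P: "prenex {1..n} m (num_quantifiers \<phi>) P" "expresses n \<rho> \<phi> P"
    and Q: "prenex {1..n} m (num_quantifiers \<psi>) Q" "expresses n \<rho> \<psi> Q"
    using Disj.IH(1)[OF Disj.prems] Disj.IH(2)[OF Disj.prems] by blast
  have "prenex {1..n} m (num_quantifiers (Disj \<phi> \<psi>)) (\<lambda>s e. P s e \<or> Q s e)"
    using prenex_disj[OF _ P(1) Q(1)] \<open>n \<ge> 1\<close> by simp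
  moreover have "expresses n \<rho> (Disj \<phi> \<psi>) (\<lambda>s e. P s e \<or> Q s e)"
    using P(2) Q(2) by (simp add: expresses_def del: comp_apply)
  ultimately show ?case by (intro exI conjI)
next
  case (Ex x \<phi>)
  have "range (\<rho>(x := m)) \<subseteq> {..<Suc m}" using Ex.prems by (force simp: less_Suc_eq)
  then obtain P where P: "prenex {1..n} (Suc m) (num_quantifiers \<phi>) P"
    and eq: "expresses n (\<rho>(x := m)) \<phi> P"
    using Ex.IH Ex.prems(2) by (meson le_SucI)
  have "prenex {1..n} m (num_quantifiers (Ex x \<phi>)) (ex_op {1..n} m P)"
    unfolding num_quantifiers.simps by (rule prenex_SucI[OF P]) simp
  moreover have "expresses n \<rho> (Ex x \<phi>) (ex_op {1..n} m P)"
    by (rule expresses_Ex[OF eq Ex.prems])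
  ultimately show ?case by (intro exI conjI)
next
  case (All x \<phi>)
  have "range (\<rho>(x := m)) \<subseteq> {..<Suc m}" using All.prems by (force simp: less_Suc_eq)
  then obtain P where P: "prenex {1..n} (Suc m) (num_quantifiers \<phi>) P"
    and eq: "expresses n (\<rho>(x := m)) \<phi> P"
    using All.IH All.prems(2) by (meson le_SucI)
  have "prenex {1..n} m (num_quantifiers (All x \<phi>)) (all_op {1..n} m P)"
    unfolding num_quantifiers.simps by (rule prenex_SucI[OF P]) simp
  moreover have "expresses n \<rho> (All x \<phi>) (all_op {1..n} m P)"
    by (rule expresses_All[OF eq All.prems])
  ultimately show ?case by (intro exI conjI)
qed

section \<open>Counting definable sets of strings\<close>

lemma sat_cong_free_vars:
  "(\<And>x. x \<in> free_vars \<phi> \<Longrightarrow> e x = e' x) \<Longrightarrow> sat B e \<phi> = sat B e' \<phi>"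
proof (induction \<phi> arbitrary: e e')
  case (Ex x \<phi>)
  have "sat B (e(x := a)) \<phi> = sat B (e'(x := a)) \<phi>" for a
    by (rule Ex.IH) (use Ex.prems in auto)
  then show ?case by simp
next
  case (All x \<phi>)
  have "sat B (e(x := a)) \<phi> = sat B (e'(x := a)) \<phi>" for a
    by (rule All.IH) (use All.prems in auto)
  then show ?case by simp
next
  case (Conj \<phi> \<psi>)
  have "sat B e \<phi> = sat B e' \<phi>" "sat B e \<psi> = sat B e' \<psi>"
    using Conj.prems by (auto intro!: Conj.IH)
  then show ?case by simp
next
  case (Disj \<phi> \<psi>)
  have "sat B e \<phi> = sat B e' \<phi>" "sat B e \<psi> = sat B e' \<psi>"
    using Disj.prems by (auto intro!: Disj.IH)
  then show ?case by simp
next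
  case (Neg \<phi>)
  have "sat B e \<phi> = sat B e' \<phi>"
    using Neg.prems by (auto intro!: Neg.IH)
  then show ?case by simp
next
  case (Eq t u)
  have "term_val B e t = term_val B e' t" "term_val B e u = term_val B e' u"
    using Eq by (cases t; cases u; simp)+
  then show ?case by simp
next
  case (Less t u)
  have "term_val B e t = term_val B e' t" "term_val B e u = term_val B e' u"
    using Less by (cases t; cases u; simp)+
  then show ?case by simp
next
  case (Bit t)
  have "term_val B e t = term_val B e' t" using Bit by (cases t; simp)
  then show ?case by simp
qed

lemma is_true_in_sentence:
  assumes "sentence \<phi>" "range e \<subseteq> universe B"
  shows "is_true_in \<phi> B \<longleftrightarrow> sat B e \<phi>"
proof -
  have "sat B e' \<phi> = sat B e \<phi>" for e'
    using assms(1) by (intro sat_cong_free_vars) (simp add: sentence_def)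
  then show ?thesis using assms(2) by (auto simp: is_true_in_def)
qed

definition definable_sets :: "nat \<Rightarrow> nat \<Rightarrow> bool list set set" where
  "definable_sets n k = {{w \<in> bit_strings n. is_true_in \<phi> (string_encoding w)} | \<phi>.
     sentence \<phi> \<and> num_quantifiers \<phi> \<le> k}"

text \<open>A sentence leaves only the two constants as free indices, so the count of prenex
  predicates applies with \<open>m = 2\<close>.\<close>

lemma card_definable_sets:
  assumes "n \<ge> 1"
  shows "finite (definable_sets n k) \<and>
    card (definable_sets n k) \<le> 2 ^ (k + (2 * (2 + k)) ^ (2 + k))"
proof -
  define c where "c = (\<lambda>i :: nat. if i = 0 then 1 else n)"
  define F where "F = (\<lambda>P. {w \<in> bit_strings n. P (S (string_encoding w)) c})"
  let ?C = "Collect (prenex {1..n} 2 k)"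
  have sub: "definable_sets n k \<subseteq> F ` ?C"
  proof
    fix X assume "X \<in> definable_sets n k"
    then obtain \<phi> where X: "X = {w \<in> bit_strings n. is_true_in \<phi> (string_encoding w)}"
      and \<phi>: "sentence \<phi>" "num_quantifiers \<phi> \<le> k"
      by (auto simp: definable_sets_def)
    obtain P where P: "prenex {1..n} 2 (num_quantifiers \<phi>) P"
      \<comment> \<open>Any renaming into the two indices would do, as a sentence has no free
        variables; here all of them denote the first position.\<close>
      and eq: "expresses n (\<lambda>_. 0) \<phi> P"
      using prenex_form[of n "\<lambda>_. 0" 2 \<phi>] assms by auto
    have "is_true_in \<phi> (string_encoding w) \<longleftrightarrow> P (S (string_encoding w)) c"
      if "w \<in> bit_strings n" for w
    proof -
      have "range (c \<circ> (\<lambda>_. 0)) \<subseteq> universe (string_encoding w)"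
        using that assms by (auto simp: c_def string_encoding_def bit_strings_def)
      then have "is_true_in \<phi> (string_encoding w)
          \<longleftrightarrow> sat (string_encoding w) (c \<circ> (\<lambda>_. 0)) \<phi>"
        by (rule is_true_in_sentence[OF \<phi>(1)])
      moreover have "length w = n \<and> c 0 = 1 \<and> c 1 = n"
        using that by (simp add: c_def bit_strings_def)
      ultimately show ?thesis
        using eq unfolding expresses_def by blast
    qed
    then have "X = F P" by (auto simp: X F_def)
    moreover have "P \<in> ?C" using prenex_mono[OF _ P \<phi>(2)] assms by simp
    ultimately show "X \<in> F ` ?C" by (rule image_eqI)
  qed
  have fin: "finite ?C" and le: "card ?C \<le> 2 ^ (k + (2 * (2 + k)) ^ (2 + k))"
    using card_prenex by blast+
  have "card (definable_sets n k) \<le> card (F ` ?C)"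
    using sub fin by (intro card_mono) auto
  also have "\<dots> \<le> card ?C" by (rule card_image_le[OF fin])
  finally show ?thesis using le finite_subset[OF sub] fin by auto
qed

lemma card_bit_strings: "finite (bit_strings n)" "card (bit_strings n) = 2 ^ n"
  using finite_lists_length_eq[of "UNIV :: bool set" n]
    card_lists_length_eq[of "UNIV :: bool set" n]
  by (simp_all add: bit_strings_def)

section \<open>Pigeonhole argument and asymptotics\<close>

lemma exists_undefinable_set:
  assumes "n \<ge> 2" and less: "k + (2 * (2 + k)) ^ (2 + k) < 2 ^ n"
  shows "\<exists>A. A \<noteq> {} \<and> A \<subset> bit_strings n \<and> A \<notin> definable_sets n k"
proof (rule ccontr)
  assume "\<not> ?thesis"
  then have sub: "Pow (bit_strings n) - {{}, bit_strings n} \<subseteq> definable_sets n k" by auto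
  let ?N = "2 ^ n :: nat"
  have "2 ^ ?N - 2 \<le> card (Pow (bit_strings n)) - card {{}, bit_strings n}"
    using card_bit_strings by (auto simp: card_Pow card_insert_if)
  also have "\<dots> \<le> card (Pow (bit_strings n) - {{}, bit_strings n})"
    by (rule diff_card_le_card_Diff) simp
  also have "\<dots> \<le> card (definable_sets n k)"
    using sub card_definable_sets assms(1) by (intro card_mono) auto
  also have "\<dots> \<le> 2 ^ (k + (2 * (2 + k)) ^ (2 + k))"
    using card_definable_sets assms(1) by simp
  \<comment> \<open>The strict bound leaves room for a factor 2: at most half of the power set is
    definable, which pays for the two excluded sets once \<open>?N \<ge> 4\<close>.\<close>
  also have "\<dots> \<le> 2 ^ (?N - 1)" using less by (intro power_increasing) auto
  finally have le: "(2::nat) ^ ?N - 2 \<le> 2 ^ (?N - 1)" .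
  have "(2::nat) ^ 2 \<le> ?N" using assms(1) by (intro power_increasing) auto
  then have N: "?N \<ge> 4" by simp
  then have "(2::nat) ^ ?N = 2 * 2 ^ (?N - 1)" by (simp flip: power_Suc)
  moreover have "(2::nat) ^ 3 \<le> 2 ^ (?N - 1)"
    using N by (intro power_increasing) linarith+
  ultimately show False using le by simp
qed

text \<open>For \<open>x = n / log n\<close>, the binary logarithm of
  \<open>(2 * (2 + x)) powr (2 + x)\<close> is n - n log log n / log n + O(n / log n). The gap of
  order n log log n / log n below n absorbs the error and the summand \<open>x\<close>.\<close>

lemma eventually_quantifier_count_less:
  "eventually (\<lambda>n::nat. \<forall>k. real k \<le> real n / log 2 (real n) \<longrightarrow>
     k + (2 * (2 + k)) ^ (2 + k) < 2 ^ n) at_top"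
proof -
  have "eventually (\<lambda>n::nat. real n / log 2 (real n) +
      (2 * (2 + real n / log 2 (real n))) powr (2 + real n / log 2 (real n)) < 2 powr real n) at_top"
    by real_asymp
  then show ?thesis
  proof eventually_elim
    case (elim n)
    show ?case
    proof (intro allI impI)
      fix k assume k: "real k \<le> real n / log 2 (real n)"
      let ?x = "real n / log 2 (real n)"
      have "(2 * (2 + real k)) powr real (2 + k) = (2 * (2 + real k)) ^ (2 + k)"
        by (rule powr_realpow) simp
      then have "real (k + (2 * (2 + k)) ^ (2 + k)) = real k + (2 * (2 + real k)) powr (2 + real k)"
        by (simp del: power_add_numeral power_Suc add_2_eq_Suc add_2_eq_Suc')
      also have "\<dots> \<le> ?x + (2 * (2 + ?x)) powr (2 + ?x)"
        \<comment> \<open>The left side grows with \<open>k\<close> in base and exponent, so the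
          real bound at \<open>?x\<close> settles all admissible \<open>k\<close> at once.\<close>
        using k by (intro add_mono powr_mono_both) auto
      also have "\<dots> < real (2 ^ n)" using elim by (simp add: powr_realpow)
      finally show "k + (2 * (2 + k)) ^ (2 + k) < 2 ^ n" by linarith
    qed
  qed
qed

theorem theorem5p6:
  "\<exists>N::nat. \<forall>n\<ge>N. \<exists>A. A \<noteq> {} \<and> A \<subset> bit_strings n \<and>
     (\<forall>\<phi>. sentence \<phi> \<longrightarrow>
        (\<forall>w\<in>A. is_true_in \<phi> (string_encoding w)) \<longrightarrow>
        (\<forall>w\<in>bit_strings n - A. \<not> is_true_in \<phi> (string_encoding w)) \<longrightarrow>
        real (num_quantifiers \<phi>) \<ge> real n / log 2 (real n))"
proof -
  obtain N where N: "\<And>n k. \<lbrakk>n \<ge> N; real k \<le> real n / log 2 (real n)\<rbrakk> \<Longrightarrow>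
      k + (2 * (2 + k)) ^ (2 + k) < 2 ^ n"
    using eventually_quantifier_count_less by (auto simp: eventually_at_top_linorder)
  show ?thesis
  proof (intro exI[of _ "max N 2"] allI impI)
    fix n assume n: "max N 2 \<le> n"
    \<comment> \<open>A quantifier count below the quotient is at most its floor. As the quotient is
      nonnegative, \<open>nat\<close> does not raise the floor, and \<open>k\<close> is admissible
      in the asymptotic bound.\<close>
    define k where "k = nat \<lfloor>real n / log 2 (real n)\<rfloor>"
    have "real n / log 2 (real n) \<ge> 0" using n by simp
    then have "real k \<le> real n / log 2 (real n)" by (simp add: k_def)
    then obtain A where A: "A \<noteq> {}" "A \<subset> bit_strings n" "A \<notin> definable_sets n k"
      using exists_undefinable_set[OF _ N, of n k] n by (meson max.bounded_iff)
    have "real n / log 2 (real n) \<le> real (num_quantifiers \<phi>)"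
      if "sentence \<phi>" "\<forall>w\<in>A. is_true_in \<phi> (string_encoding w)"
        "\<forall>w\<in>bit_strings n - A. \<not> is_true_in \<phi> (string_encoding w)" for \<phi>
    proof (rule ccontr)
      assume "\<not> ?thesis"
      then have "num_quantifiers \<phi> \<le> k" unfolding k_def by (simp add: le_nat_floor)
      moreover have "A = {w \<in> bit_strings n. is_true_in \<phi> (string_encoding w)}"
        using that A(2) by auto
      ultimately show False using A(3) that(1) by (auto simp: definable_sets_def)
    qed
    then show "\<exists>A. A \<noteq> {} \<and> A \<subset> bit_strings n \<and>
     (\<forall>\<phi>. sentence \<phi> \<longrightarrow>
        (\<forall>w\<in>A. is_true_in \<phi> (string_encoding w)) \<longrightarrow>
        (\<forall>w\<in>bit_strings n - A. \<not> is_true_in \<phi> (string_encoding w)) \<longrightarrow>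
        real (num_quantifiers \<phi>) \<ge> real n / log 2 (real n))"
      using A by blast
  qed
qed

end
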